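(* For every natural number $n\geq 2$, \[ \varphi^4(n)+\psi^4(n)+\sigma^4(n)\geq 3n^4+4n^3+18n^2+4n+3. \]
   Context: For a natural number $n$, $\varphi(n)$ is Euler's totient function (the number of positive integers not exceeding $n$ that are coprime to $n$). For $n=p_1^{a_1}\cdots p_k^{a_k}$ (distinct primes $p_i$, $a_i\geq1$), the Dedekind function is $\psi(n)=\prod_{i=1}^k p_i^{a_i-1}(p_i+1)$, with $\psi(1)=1$. $\sigma(n)$ denotes the sum of the positive divisors of $n$. *)

theory Defs
  imports "HOL-Number_Theory.Number_Theory"
begin

(* The value at 0 is irrelevant; the empty product gives dedekind_psi 1 = 1. *)
definition dedekind_psi :: "nat \<Rightarrow> nat" where
  "dedekind_psi n = (\<Prod>p\<in>prime_factors n. p ^ (multiplicity p n - 1) * (p + 1))"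

definition divisor_sum :: "nat \<Rightarrow> nat" where
  "divisor_sum n = (\<Sum>d | d dvd n. d)"

end

theory Submission
  imports Defs
begin

text \<open>
  Put \<open>s = n - \<phi>(n)\<close>, so \<open>s \<ge> 1\<close> for \<open>n \<ge> 2\<close>. Since
  \<open>\<Prod>(1 - 1/p) + \<Prod>(1 + 1/p) \<ge> 2\<close>, we have \<open>\<phi>(n) + \<psi>(n) \<ge> 2n\<close>, and therefore
  \<open>\<sigma>(n) \<ge> \<psi>(n) \<ge> n + s\<close>. Hence the left-hand side is at least
  \<open>(n - s)^4 + 2(n + s)^4 = 3n^4 + 4n^3s + 18n^2s^2 + 4ns^3 + 3s^4\<close>, which is increasing in \<open>s\<close>
  and equals the right-hand side at \<open>s = 1\<close>, the case of prime \<open>n\<close>.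
\<close>

text \<open>In the induction the factors for \<open>j\<close> add \<open>x j * (b - a)\<close> to
  the sum of the two products. This is nonnegative since \<open>a \<le> b\<close> factor by factor;
  \<open>x i \<le> 1\<close> keeps the factors of \<open>a\<close> nonnegative, as that comparison
  requires.\<close>

lemma prod_one_minus_plus_prod_one_plus_ge_2:
  fixes x :: "'a \<Rightarrow> real"
  assumes "finite A" "\<And>i. i \<in> A \<Longrightarrow> 0 \<le> x i" "\<And>i. i \<in> A \<Longrightarrow> x i \<le> 1"
  shows "(\<Prod>i\<in>A. 1 - x i) + (\<Prod>i\<in>A. 1 + x i) \<ge> 2"
  using assms
proof (induction A rule: finite_induct)
  case (insert j A)
  define a where "a = (\<Prod>i\<in>A. 1 - x i)"
  define b where "b = (\<Prod>i\<in>A. 1 + x i)"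
  have "a \<le> b"
    unfolding a_def b_def using insert.prems by (intro prod_mono) force
  have "2 \<le> a + b"
    unfolding a_def b_def using insert.prems by (intro insert.IH) auto
  moreover have "(1 - x j) * a + (1 + x j) * b = (a + b) + x j * (b - a)"
    by (simp add: algebra_simps)
  moreover have "0 \<le> x j * (b - a)"
    using insert.prems \<open>a \<le> b\<close> by (intro mult_nonneg_nonneg) auto
  ultimately have "2 \<le> (1 - x j) * a + (1 + x j) * b"
    by linarith
  then show ?case
    using insert.hyps by (simp add: a_def b_def)
qed simp

text \<open>This shape parallels Euler's product \<open>totient_formula2\<close>, so that n factors
  out of the sum of the two functions.\<close>

lemma dedekind_psi_conv_prod:
  assumes "n > 0"
  shows "real (dedekind_psi n) = real n * (\<Prod>p\<in>prime_factors n. 1 + 1 / real p)"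
proof -
  have "real (dedekind_psi n)
          = (\<Prod>p\<in>prime_factors n. real (p ^ (multiplicity p n - 1) * (p + 1)))"
    by (simp add: dedekind_psi_def)
  also have "\<dots> = (\<Prod>p\<in>prime_factors n. real (p ^ multiplicity p n) * (1 + 1 / real p))"
  proof (intro prod.cong refl)
    fix p assume p: "p \<in> prime_factors n"
    \<comment> \<open>A positive multiplicity keeps the natural-number subtraction in the exponent
      from truncating.\<close>
    then have "multiplicity p n > 0"
      by (simp add: prime_factors_multiplicity)
    then obtain k where "multiplicity p n = Suc k"
      using gr0_implies_Suc by blast
    moreover have "p > 0"
      using in_prime_factors_imp_prime[OF p] by (rule prime_gt_0_nat)
    ultimately show "real (p ^ (multiplicity p n - 1) * (p + 1))
                       = real (p ^ multiplicity p n) * (1 + 1 / real p)"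
      by (simp add: field_simps)
  qed
  also have "\<dots> = real (\<Prod>p\<in>prime_factors n. p ^ multiplicity p n)
                    * (\<Prod>p\<in>prime_factors n. 1 + 1 / real p)"
    by (simp add: prod.distrib)
  also have "(\<Prod>p\<in>prime_factors n. p ^ multiplicity p n) = n"
    using prime_factorization_nat[OF assms] by simp
  finally show ?thesis .
qed

lemma totient_plus_dedekind_psi_ge:
  assumes "n > 0"
  shows "totient n + dedekind_psi n \<ge> 2 * n"
proof -
  have "(\<Prod>p\<in>prime_factors n. 1 - 1 / real p) + (\<Prod>p\<in>prime_factors n. 1 + 1 / real p) \<ge> 2"
    by (intro prod_one_minus_plus_prod_one_plus_ge_2)
       (auto simp: field_simps dest!: prime_gt_0_nat[OF in_prime_factors_imp_prime])
  then have "real n * 2 \<le> real n * ((\<Prod>p\<in>prime_factors n. 1 - 1 / real p)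
                                      + (\<Prod>p\<in>prime_factors n. 1 + 1 / real p))"
    by (intro mult_left_mono) auto
  also have "\<dots> = real (totient n + dedekind_psi n)"
    using assms by (simp add: totient_formula2 dedekind_psi_conv_prod distrib_left)
  finally show ?thesis
    by linarith
qed

text \<open>A finite set of primes is recovered from its product as the set of prime divisors of
  that product.\<close>

lemma inj_on_prod_sets_of_primes:
  "inj_on (\<lambda>S. \<Prod>S) {S :: nat set. finite S \<and> (\<forall>p\<in>S. prime p)}"
proof (rule inj_on_inverseI)
  fix S :: "nat set"
  assume S: "S \<in> {S. finite S \<and> (\<forall>p\<in>S. prime p)}"
  have "p dvd \<Prod>S \<longleftrightarrow> p \<in> S" if "prime p" for p
    using that S by (auto simp: prime_dvd_prod_iff dest: primes_dvd_imp_eq intro: dvd_refl)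
  then show "{p. prime p \<and> p dvd \<Prod>S} = S"
    using S by auto
qed

text \<open>Expanding the product \<open>\<Prod>(p + 1)\<close> writes \<open>\<psi>(n)\<close> as a sum of distinct divisors of \<open>n\<close>.\<close>

lemma dedekind_psi_le_divisor_sum:
  assumes "n > 0"
  shows "dedekind_psi n \<le> divisor_sum n"
proof -
  define P where "P = prime_factors n"
  \<comment> \<open>\<open>m\<close> is n divided by its radical, so \<open>m\<close> times the
    product of any subset of \<open>P\<close> divides n.\<close>
  define m where "m = (\<Prod>p\<in>P. p ^ (multiplicity p n - 1))"
  have fin: "finite P" and prime: "\<And>p. p \<in> P \<Longrightarrow> prime p"
    by (auto simp: P_def)
  have "m * \<Prod>P = (\<Prod>p\<in>P. p ^ multiplicity p n)"
    unfolding m_def prod.distrib [symmetric]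
    by (intro prod.cong refl)
       (auto simp: P_def prime_factors_multiplicity simp flip: power_Suc2)
  also have "\<dots> = n"
    using prime_factorization_nat[OF assms] by (simp add: P_def)
  finally have n_eq: "m * \<Prod>P = n" .
  have "m > 0"
    using n_eq assms by (cases "m = 0") auto
  \<comment> \<open>Distinct subsets give distinct divisors, so no divisor is counted twice when the
    expanded product is read as a sum over divisors.\<close>
  have inj: "inj_on (\<lambda>S. m * \<Prod>S) (Pow P)"
  proof (rule inj_onI)
    fix S T
    assume "S \<in> Pow P" "T \<in> Pow P" "m * \<Prod>S = m * \<Prod>T"
    with \<open>m > 0\<close> fin prime show "S = T"
      by (intro inj_onD[OF inj_on_prod_sets_of_primes]) (auto intro: finite_subset)
  qed
  have "dedekind_psi n = m * (\<Prod>p\<in>P. p + 1)"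
    by (simp only: dedekind_psi_def m_def P_def prod.distrib)
  also have "\<dots> = (\<Sum>S\<in>Pow P. m * \<Prod>S)"
    by (subst prod_add[OF fin]) (simp add: sum_distrib_left)
  also have "\<dots> = \<Sum>((\<lambda>S. m * \<Prod>S) ` Pow P)"
    by (simp add: sum.reindex[OF inj])
  also have "\<dots> \<le> \<Sum>{d. d dvd n}"
  proof (rule sum_mono2)
    show "(\<lambda>S. m * \<Prod>S) ` Pow P \<subseteq> {d. d dvd n}"
      using fin by (auto simp flip: n_eq intro!: mult_dvd_mono prod_dvd_prod_subset)
  qed (use assms in auto)
  finally show ?thesis
    by (simp add: divisor_sum_def)
qed

theorem theorem2:
  fixes n :: nat
  assumes "n \<ge> 2"
  shows "totient n ^ 4 + dedekind_psi n ^ 4 + divisor_sum n ^ 4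
           \<ge> 3 * n ^ 4 + 4 * n ^ 3 + 18 * n ^ 2 + 4 * n + 3"
proof -
  define x where "x = real n"
  define s where "s = real n - real (totient n)"
  have "totient n < n"
    using assms by (intro totient_less) simp
  then have s: "s \<ge> 1"
    by (simp add: s_def)
  have "x \<ge> 0"
    by (simp add: x_def)
  have psi: "x + s \<le> real (dedekind_psi n)"
    using totient_plus_dedekind_psi_ge[of n] assms by (simp add: x_def s_def)
  also have "real (dedekind_psi n) \<le> real (divisor_sum n)"
    using dedekind_psi_le_divisor_sum[of n] assms by simp
  finally have sigma: "x + s \<le> real (divisor_sum n)" .
  have pow: "1 \<le> s ^ k" for k
    using s by simp
  \<comment> \<open>The explicit factors 1 pair each term with one carrying a power of
    \<open>s\<close>, so the comparison goes term by term.\<close>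
  have "3 * x ^ 4 + 4 * x ^ 3 * 1 + 18 * x ^ 2 * 1 + 4 * x * 1 + 3 * 1
          \<le> 3 * x ^ 4 + 4 * x ^ 3 * s + 18 * x ^ 2 * s ^ 2 + 4 * x * s ^ 3 + 3 * s ^ 4"
    using s pow \<open>x \<ge> 0\<close> by (intro add_mono mult_left_mono order_refl) auto
  also have "\<dots> = (x - s) ^ 4 + (x + s) ^ 4 + (x + s) ^ 4"
    by (simp add: power4_eq_xxxx power3_eq_cube power2_eq_square algebra_simps)
  \<comment> \<open>Here \<open>x - s\<close> is exactly \<open>real (totient n)\<close>, so every
    base is nonnegative and fourth powers preserve the inequalities.\<close>
  also have "\<dots> \<le> real (totient n) ^ 4 + real (dedekind_psi n) ^ 4 + real (divisor_sum n) ^ 4"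
    using psi sigma s \<open>x \<ge> 0\<close>
    by (intro add_mono power_mono) (auto simp: x_def s_def)
  finally have "real (3 * n ^ 4 + 4 * n ^ 3 + 18 * n ^ 2 + 4 * n + 3)
                  \<le> real (totient n ^ 4 + dedekind_psi n ^ 4 + divisor_sum n ^ 4)"
    by (simp add: x_def)
  then show ?thesis
    by (simp only: of_nat_le_iff)
qed

end
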